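(* Each $h_1$-singular normal arc $\lambda_t$, $t\in I$, of the time-optimal problem on the Cartan group described in the context satisfies one of the following conditions on $I$: (a) $h_1=h_3=h_4=h_5\equiv0$, $h_2\equiv\mathrm{const}\neq0$, and $|u_1(t)|\le1$, $u_2\equiv s_2\in\{\pm1\}$; (b) $h_1=h_3\equiv0$, $h_4\ne0$, $\left|\frac{h_5}{h_4}\right|\le1$, $h_2\equiv\mathrm{const}\ne0$, and $u_1(t)\equiv u_1^a=-s_2\frac{h_5}{h_4}$, $u_2(t)\equiv s_2\in\{\pm1\}$.
   Context: Let $M=\mathbb R^5$ with coordinates $(x,y,z,v,w)$, and let $X_1=\partial_x-\frac y2\partial_z-\frac{x^2+y^2}{2}\partial_w$, $X_2=\partial_y+\frac x2\partial_z+\frac{x^2+y^2}{2}\partial_v$, $X_3=\partial_z+x\partial_v+y\partial_w$, $X_4=\partial_v$, $X_5=\partial_w$ (left-invariant fields on the Cartan group $M$, with identity $\mathrm{Id}=0$; nonzero brackets $[X_1,X_2]=X_3$, $[X_1,X_3]=X_4$, $[X_2,X_3]=X_5$). Time-optimal problem: $\dot q=u_1X_1(q)+u_2X_2(q)$, $u=(u_1,u_2)$ measurable with values in $U=\{u\in\mathbb R^2:\max(|u_1|,|u_2|)\le 1\}$, $q(0)=\mathrm{Id}$, $q(T)=q_1$, $T\to\min$. Equalities and inequalities for controls are understood for a.e. $t$. For $\lambda\in T^*M$ set $h_i(\lambda)=\langle\lambda,X_i\rangle$, $i=1,\dots,5$, and $H=|h_1|+|h_2|$. A normal extremal is a Lipschitz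 curve $\lambda_t\in T^*_{q(t)}M$, $t\in[0,T]$, with an admissible control $u$, satisfying $\dot h_1=-u_2h_3$, $\dot h_2=u_1h_3$, $\dot h_3=u_1h_4+u_2h_5$, $\dot h_4=\dot h_5=0$, $\dot q=u_1X_1+u_2X_2$, the maximum condition $u_1(t)h_1(\lambda_t)+u_2(t)h_2(\lambda_t)=\max_{v\in U}(v_1h_1+v_2h_2)(\lambda_t)=H(\lambda_t)$, and $H(\lambda_t)\equiv\mathrm{const}>0$. An $h_1$-singular normal arc is the restriction of a normal extremal to an open interval $I=(\alpha,\beta)\subset[0,T]$ on which $h_1(\lambda_t)\equiv0$. *)

theory Defs
  imports "HOL-Analysis.Analysis"
begin

text \<open>
  The Cartan group is \<open>M = \<real>\<^sup>5\<close> with coordinates \<open>(x, y, z, v, w)\<close> given by the components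
  \<open>1, \<dots>, 5\<close>, and \<open>axis i 1\<close> is the \<open>i\<close>-th coordinate vector field.
\<close>

definition X1 :: "real^5 \<Rightarrow> real^5" where
  "X1 q = axis 1 1 - (q$2 / 2) *\<^sub>R axis 3 1 - (((q$1)\<^sup>2 + (q$2)\<^sup>2) / 2) *\<^sub>R axis 5 1"

definition X2 :: "real^5 \<Rightarrow> real^5" where
  "X2 q = axis 2 1 + (q$1 / 2) *\<^sub>R axis 3 1 + (((q$1)\<^sup>2 + (q$2)\<^sup>2) / 2) *\<^sub>R axis 4 1"

definition X3 :: "real^5 \<Rightarrow> real^5" where
  "X3 q = axis 3 1 + q$1 *\<^sub>R axis 4 1 + q$2 *\<^sub>R axis 5 1"

definition X4 :: "real^5 \<Rightarrow> real^5" where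
  "X4 q = axis 4 1"

definition X5 :: "real^5 \<Rightarrow> real^5" where
  "X5 q = axis 5 1"

text \<open>
  \<open>T\<^sup>*M\<close> is trivialised by the coordinates: \<open>(q, p)\<close> is the covector \<open>p\<close> at the point \<open>q\<close>, and the
  pairing with a tangent vector at \<open>q\<close> is the inner product of coordinates.
\<close>

type_synonym cotangent = "(real^5) \<times> (real^5)"

definition lin_ham :: "(real^5 \<Rightarrow> real^5) \<Rightarrow> cotangent \<Rightarrow> real" where
  "lin_ham X l = snd l \<bullet> X (fst l)"

abbreviation h1 :: "cotangent \<Rightarrow> real" where "h1 \<equiv> lin_ham X1"
abbreviation h2 :: "cotangent \<Rightarrow> real" where "h2 \<equiv> lin_ham X2"
abbreviation h3 :: "cotangent \<Rightarrow> real" where "h3 \<equiv> lin_ham X3"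
abbreviation h4 :: "cotangent \<Rightarrow> real" where "h4 \<equiv> lin_ham X4"
abbreviation h5 :: "cotangent \<Rightarrow> real" where "h5 \<equiv> lin_ham X5"

definition Ham :: "cotangent \<Rightarrow> real" where
  "Ham l = \<bar>h1 l\<bar> + \<bar>h2 l\<bar>"

definition U :: "(real^2) set" where
  "U = {u. max \<bar>u$1\<bar> \<bar>u$2\<bar> \<le> 1}"

text \<open>Relations involving controls are required almost everywhere.\<close>

definition admissible_control :: "real \<Rightarrow> (real \<Rightarrow> real^2) \<Rightarrow> bool" where
  "admissible_control T u \<longleftrightarrow>
     u \<in> borel_measurable (lebesgue_on {0..T}) \<and> (AE t in lebesgue_on {0..T}. u t \<in> U)"

definition extremal_ode_at :: "real \<Rightarrow> (real \<Rightarrow> real^2) \<Rightarrow> (real \<Rightarrow> cotangent) \<Rightarrow> real \<Rightarrow> bool" where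
  "extremal_ode_at T u l t \<longleftrightarrow>
     ((\<lambda>t. h1 (l t)) has_real_derivative - (u t $ 2) * h3 (l t)) (at t within {0..T}) \<and>
     ((\<lambda>t. h2 (l t)) has_real_derivative u t $ 1 * h3 (l t)) (at t within {0..T}) \<and>
     ((\<lambda>t. h3 (l t)) has_real_derivative u t $ 1 * h4 (l t) + u t $ 2 * h5 (l t))
       (at t within {0..T}) \<and>
     ((\<lambda>t. h4 (l t)) has_real_derivative 0) (at t within {0..T}) \<and>
     ((\<lambda>t. h5 (l t)) has_real_derivative 0) (at t within {0..T}) \<and>
     ((\<lambda>t. fst (l t)) has_vector_derivative
        u t $ 1 *\<^sub>R X1 (fst (l t)) + u t $ 2 *\<^sub>R X2 (fst (l t))) (at t within {0..T})"

text \<open>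
  Together with \<open>u t \<in> U\<close>, the first conjunct says that the maximum over \<open>U\<close> is attained at \<open>u t\<close>.
\<close>

definition maximum_condition_at :: "(real \<Rightarrow> real^2) \<Rightarrow> (real \<Rightarrow> cotangent) \<Rightarrow> real \<Rightarrow> bool" where
  "maximum_condition_at u l t \<longleftrightarrow>
     (\<forall>v\<in>U. v$1 * h1 (l t) + v$2 * h2 (l t) \<le> u t $ 1 * h1 (l t) + u t $ 2 * h2 (l t)) \<and>
     u t $ 1 * h1 (l t) + u t $ 2 * h2 (l t) = Ham (l t)"

definition normal_extremal :: "real \<Rightarrow> (real \<Rightarrow> real^2) \<Rightarrow> (real \<Rightarrow> cotangent) \<Rightarrow> bool" where
  "normal_extremal T u l \<longleftrightarrow>
     admissible_control T u \<and>
     (\<exists>L. L-lipschitz_on {0..T} l) \<and>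
     (AE t in lebesgue_on {0..T}. extremal_ode_at T u l t) \<and>
     (AE t in lebesgue_on {0..T}. maximum_condition_at u l t) \<and>
     (\<exists>c>0. \<forall>t\<in>{0..T}. Ham (l t) = c)"

definition h1_singular_normal_arc ::
  "real \<Rightarrow> (real \<Rightarrow> real^2) \<Rightarrow> (real \<Rightarrow> cotangent) \<Rightarrow> real \<Rightarrow> real \<Rightarrow> bool" where
  "h1_singular_normal_arc T u l \<alpha> \<beta> \<longleftrightarrow>
     normal_extremal T u l \<and> \<alpha> < \<beta> \<and> {\<alpha><..<\<beta>} \<subseteq> {0..T} \<and> (\<forall>t\<in>{\<alpha><..<\<beta>}. h1 (l t) = 0)"

end

theory Submission
  imports Defs
begin

text \<open>
  Where \<open>h1\<close> vanishes, \<open>\<bar>h2\<bar>\<close> is the positive constant \<open>H\<close>, so \<open>h2\<close> is constant and the maximum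
  condition gives \<open>u2 = sgn h2\<close> almost everywhere. Differentiating \<open>h1 = 0\<close> yields \<open>h3 = 0\<close> almost
  everywhere, hence everywhere by continuity; differentiating \<open>h3 = 0\<close> yields
  \<open>u1 h4 + u2 h5 = 0\<close> almost everywhere. As \<open>h4\<close> and \<open>h5\<close> are Lipschitz with derivative zero almost
  everywhere, they are constant, and the two cases are \<open>h4 = 0\<close> and \<open>h4 \<noteq> 0\<close>.
\<close>

text \<open>Every point of \<open>S\<close> is critical, so this is the one-dimensional case of
  Sard's theorem, with derivatives taken only within \<open>S\<close>.\<close>

lemma negligible_image_zero_derivative:
  fixes f :: "real \<Rightarrow> real"
  assumes "\<And>t. t \<in> S \<Longrightarrow> (f has_real_derivative 0) (at t within S)"
  shows "negligible (f ` S)"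
proof -
  \<comment> \<open>\<open>baby_Sard\<close> concerns maps between spaces \<open>real^n\<close>, so
    \<open>f\<close> is conjugated with the isomorphism \<open>vec\<close> of the line with
    \<open>real^1\<close>. The derivative of \<open>g\<close> is then the zero matrix, of rank 0 <
    1.\<close>
  define g :: "real^1 \<Rightarrow> real^1" where "g x = vec (f (x$1))" for x
  have "negligible (g ` (vec ` S))"
  proof (rule baby_Sard)
    fix x :: "real^1" assume "x \<in> vec ` S"
    then obtain t where t: "t \<in> S" "x = vec t" by blast
    have im: "(\<lambda>x::real^1. x$1) ` vec ` S = S" by (simp add: image_image)
    have "(f has_derivative (\<lambda>_. 0)) (at (x$1) within (\<lambda>x::real^1. x$1) ` vec ` S)"
      using assms[OF t(1)] t(2) unfolding im
      by (simp add: has_field_derivative_def lambda_zero)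
    moreover have "((\<lambda>x::real^1. x$1) has_derivative (\<lambda>x. x$1)) (at x within vec ` S)"
      by (simp add: bounded_linear_vec_nth bounded_linear_imp_has_derivative)
    ultimately have "((\<lambda>x. f (x$1)) has_derivative (\<lambda>_. 0)) (at x within vec ` S)"
      by (rule has_derivative_in_compose[rotated])
    moreover have "bounded_linear (vec :: real \<Rightarrow> real^1)"
      by (simp add: linear_linear)
    ultimately have "(g has_derivative (\<lambda>_. vec 0)) (at x within vec ` S)"
      unfolding g_def using bounded_linear.has_derivative by blast
    then show "(g has_derivative (\<lambda>_. 0)) (at x within vec ` S)"
      by simp
  next
    have "matrix (\<lambda>_::real^1. 0::real^1) = 0"
      by (simp add: matrix_def vec_eq_iff)
    then show "rank (matrix (\<lambda>_::real^1. 0::real^1)) < CARD(1)"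
      by simp
  qed simp
  \<comment> \<open>Back to the line: the coordinate projection is 1-Lipschitz and preserves the
    dimension, so it keeps negligible sets negligible.\<close>
  then have "negligible ((\<lambda>x. x$1) ` g ` vec ` S)"
    by (rule negligible_locally_Lipschitz_image[rotated])
      (use component_le_norm_cart[of _ "1::1"] in
        \<open>auto intro!: exI[where x = UNIV] exI[where x = "1::real"]
          simp flip: vector_minus_component real_norm_def\<close>)
  then show ?thesis by (simp add: image_image g_def)
qed

text \<open>
  The image of \<open>S\<close> is negligible, by the Lipschitz property on the exceptional null set and by
  Sard's theorem off it; but it is an interval.
\<close>

lemma lipschitz_AE_zero_derivative_constant_on:
  fixes f :: "real \<Rightarrow> real"
  assumes lip: "L-lipschitz_on S f" and S: "connected S"
    and der: "AE t in lebesgue. t \<in> S \<longrightarrow> (f has_real_derivative 0) (at t within S)"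
  shows "f constant_on S"
proof -
  obtain N where N: "negligible N"
      "{t. \<not> (t \<in> S \<longrightarrow> (f has_real_derivative 0) (at t within S))} \<subseteq> N"
    using der unfolding eventually_ae_filter_negligible by blast
  have "negligible (f ` (S - N))"
    using N(2) by (intro negligible_image_zero_derivative)
      (blast intro: has_field_derivative_subset)
  moreover have "negligible (f ` (S \<inter> N))"
  proof (rule negligible_locally_Lipschitz_image)
    show "negligible (S \<inter> N)" using N(1) by (simp add: negligible_Int)
    show "\<exists>T B. open T \<and> x \<in> T \<and> (\<forall>y\<in>S \<inter> N \<inter> T. norm (f y - f x) \<le> B * norm (y - x))"
      if "x \<in> S \<inter> N" for x
      using lipschitz_onD[OF lip] that
      by (intro exI[of _ UNIV] exI[of _ L]) (auto simp: dist_norm)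
  qed simp
  moreover have "f ` S = f ` (S - N) \<union> f ` (S \<inter> N)" by blast
  ultimately have neg: "negligible (f ` S)" by (simp add: negligible_Un)
  have conn: "connected (f ` S)"
    using lip S by (intro connected_continuous_image lipschitz_on_continuous_on)
  have "\<not> f s < f t" if "s \<in> S" "t \<in> S" for s t
  proof
    assume "f s < f t"
    have "cbox (f s) (f t) \<subseteq> f ` S"
      using conn that connected_contains_Icc[of "f ` S" "f s" "f t"] by auto
    with neg have "negligible (cbox (f s) (f t))" by (rule negligible_subset)
    then have "box (f s) (f t) = {}" using negligible_interval(1) by blast
    with \<open>f s < f t\<close> show False by simp
  qed
  then show ?thesis unfolding constant_on_def by (meson linorder_less_linear)
qed

text \<open>The points of \<open>S\<close> with \<open>f\<close> nonzero form an open set by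
  continuity and a negligible one by assumption; a nonempty open set is never negligible.\<close>

lemma AE_zero_continuous_open:
  fixes f :: "'a::euclidean_space \<Rightarrow> real"
  assumes S: "open S" and f: "continuous_on S f"
    and ae: "AE t in lebesgue. t \<in> S \<longrightarrow> f t = 0" and t: "t \<in> S"
  shows "f t = 0"
proof -
  obtain N where N: "negligible N" "{t. \<not> (t \<in> S \<longrightarrow> f t = 0)} \<subseteq> N"
    using ae unfolding eventually_ae_filter_negligible by blast
  have "S \<inter> f -` (- {0}) \<subseteq> N" using N(2) by blast
  then have "negligible (S \<inter> f -` (- {0}))" using N(1) negligible_subset by blast
  moreover have "open (S \<inter> f -` (- {0}))"
    using f S by (intro continuous_open_preimage) auto
  ultimately have "S \<inter> f -` (- {0}) = {}" using open_not_negligible by blast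
  then show ?thesis using t by blast
qed

text \<open>At a point of the open set \<open>I\<close> the derivative within \<open>A\<close> is
  the two-sided one, and it depends only on the values on \<open>I\<close>; uniqueness of
  derivatives gives the claim. In the application \<open>d\<close> is the right-hand side of an
  equation of the extremal and \<open>A\<close> is \<open>{0..T}\<close>.\<close>

lemma zero_on_open_imp_derivative_zero:
  fixes f :: "real \<Rightarrow> real"
  assumes der: "(f has_real_derivative d) (at t within A)"
    and I: "open I" "I \<subseteq> A" "t \<in> I" and zero: "\<And>s. s \<in> I \<Longrightarrow> f s = 0"
  shows "d = 0"
proof -
  have "(f has_real_derivative d) (at t)"
    using has_field_derivative_subset[OF der I(2)] unfolding at_within_open[OF I(3,1)] .
  moreover have "(f has_real_derivative 0) (at t)"
    by (rule has_field_derivative_transform_within_open[OF DERIV_const[of 0] I(1,3)]) (simp add: zero)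
  ultimately show ?thesis by (rule DERIV_unique)
qed

text \<open>Meant for \<open>h4\<close> and \<open>h5\<close>, whose fields are constant in the
  coordinates. The pairing then ignores the base point and is linear in the momentum with norm at
  most 1, so the constant \<open>L\<close> is inherited.\<close>

lemma lipschitz_on_lin_ham_const:
  assumes "L-lipschitz_on S l" and "norm a \<le> 1"
  shows "L-lipschitz_on S (\<lambda>t. lin_ham (\<lambda>_. a) (l t))"
proof (rule lipschitz_onI)
  fix s t assume st: "s \<in> S" "t \<in> S"
  have "dist (lin_ham (\<lambda>_. a) (l s)) (lin_ham (\<lambda>_. a) (l t)) = \<bar>(snd (l s) - snd (l t)) \<bullet> a\<bar>"
    by (simp add: lin_ham_def dist_real_def inner_diff_left)
  also have "\<dots> \<le> norm (snd (l s) - snd (l t)) * norm a" by (rule Cauchy_Schwarz_ineq2)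
  also have "\<dots> \<le> norm (snd (l s) - snd (l t))" using assms(2) by (simp add: mult_left_le)
  also have "\<dots> \<le> dist (l s) (l t)" by (metis dist_norm dist_snd_le)
  also have "\<dots> \<le> L * dist s t" by (rule lipschitz_onD[OF assms(1) st])
  finally show "dist (lin_ham (\<lambda>_. a) (l s)) (lin_ham (\<lambda>_. a) (l t)) \<le> L * dist s t" .
qed (rule lipschitz_on_nonneg[OF assms(1)])

lemma continuous_on_h2: "continuous_on S l \<Longrightarrow> continuous_on S (\<lambda>t. h2 (l t))"
  unfolding lin_ham_def X2_def
  by (intro continuous_on_inner continuous_on_add continuous_on_scaleR continuous_on_divide
      continuous_on_power continuous_on_component continuous_on_fst continuous_on_snd
      continuous_on_const) simp_all

lemma continuous_on_h3: "continuous_on S l \<Longrightarrow> continuous_on S (\<lambda>t. h3 (l t))"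
  unfolding lin_ham_def X3_def
  by (intro continuous_on_inner continuous_on_add continuous_on_scaleR
      continuous_on_component continuous_on_fst continuous_on_snd continuous_on_const)

theorem theorem4:
  fixes T \<alpha> \<beta> :: real
    and u :: "real \<Rightarrow> real^2"
    and l :: "real \<Rightarrow> cotangent"
  assumes "h1_singular_normal_arc T u l \<alpha> \<beta>"
  shows
    "((\<forall>t\<in>{\<alpha><..<\<beta>}. h1 (l t) = 0 \<and> h3 (l t) = 0 \<and> h4 (l t) = 0 \<and> h5 (l t) = 0) \<and>
      (\<exists>c. c \<noteq> 0 \<and> (\<forall>t\<in>{\<alpha><..<\<beta>}. h2 (l t) = c)) \<and>
      (\<exists>s2\<in>{1, -1}. AE t in lebesgue_on {\<alpha><..<\<beta>}. \<bar>u t $ 1\<bar> \<le> 1 \<and> u t $ 2 = s2))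
   \<or> ((\<forall>t\<in>{\<alpha><..<\<beta>}. h1 (l t) = 0 \<and> h3 (l t) = 0 \<and> h4 (l t) \<noteq> 0 \<and> \<bar>h5 (l t) / h4 (l t)\<bar> \<le> 1) \<and>
      (\<exists>c. c \<noteq> 0 \<and> (\<forall>t\<in>{\<alpha><..<\<beta>}. h2 (l t) = c)) \<and>
      (\<exists>s2\<in>{1, -1}. AE t in lebesgue_on {\<alpha><..<\<beta>}.
          u t $ 1 = - s2 * (h5 (l t) / h4 (l t)) \<and> u t $ 2 = s2))"
proof -
  define I where "I = {\<alpha><..<\<beta>}"
  from assms have ext: "normal_extremal T u l" and "\<alpha> < \<beta>" and IT: "I \<subseteq> {0..T}"
    and h1: "\<And>t. t \<in> I \<Longrightarrow> h1 (l t) = 0"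
    by (auto simp: h1_singular_normal_arc_def I_def)
  have I: "open I" "connected I" by (auto simp: I_def)
  obtain t0 where t0: "t0 \<in> I" using \<open>\<alpha> < \<beta>\<close> dense by (auto simp: I_def)
  obtain c where c: "c > 0" "\<And>t. t \<in> I \<Longrightarrow> Ham (l t) = c"
    using ext IT by (auto simp: normal_extremal_def)
  obtain L where "L-lipschitz_on {0..T} l" using ext by (auto simp: normal_extremal_def)
  then have lip: "L-lipschitz_on I l" using IT by (rule lipschitz_on_subset)
  then have cont: "continuous_on I l" by (rule lipschitz_on_continuous_on)
  \<comment> \<open>Facts that hold almost everywhere are kept as implications over
    \<open>lebesgue\<close>, the form used by the lemmas above; \<open>to_I\<close> returns to the
    form of the conclusion.\<close>
  have restrict: "AE t in lebesgue. t \<in> I \<longrightarrow> P t" if "AE t in lebesgue_on {0..T}. P t" for P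
    using that IT by (auto simp: AE_restrict_space_iff elim!: eventually_mono)
  have to_I: "AE t in lebesgue_on {\<alpha><..<\<beta>}. P t" if "AE t in lebesgue. t \<in> I \<longrightarrow> P t" for P
    using that by (simp add: AE_restrict_space_iff I_def)
  have ode: "AE t in lebesgue. t \<in> I \<longrightarrow> extremal_ode_at T u l t"
    and max: "AE t in lebesgue. t \<in> I \<longrightarrow> maximum_condition_at u l t"
    and adm: "AE t in lebesgue. t \<in> I \<longrightarrow> u t \<in> U"
    using ext by (auto intro!: restrict simp: normal_extremal_def admissible_control_def)

  have abs_h2: "\<bar>h2 (l t)\<bar> = c" if "t \<in> I" for t
    using c(2)[OF that] h1[OF that] by (simp add: Ham_def)
  \<comment> \<open>A continuous function with finitely many values on a connected set is constant,
    so \<open>h2\<close> cannot switch between \<open>c\<close> and \<open>-c\<close>.\<close>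
  have "(\<lambda>t. h2 (l t)) ` I \<subseteq> {c, -c}" using abs_h2 by fastforce
  then have "(\<lambda>t. h2 (l t)) constant_on I"
    using continuous_on_h2[OF cont] I(2)
    by (intro continuous_finite_range_constant) (auto intro: finite_subset)
  then obtain k where k: "\<And>t. t \<in> I \<Longrightarrow> h2 (l t) = k" by (auto simp: constant_on_def)
  have "k \<noteq> 0" using abs_h2[OF t0] k[OF t0] c(1) by auto
  define s2 where "s2 = sgn k"
  have s2: "s2 \<in> {1, -1}" using \<open>k \<noteq> 0\<close> by (auto simp: s2_def sgn_if)
  have u2: "AE t in lebesgue. t \<in> I \<longrightarrow> u t $ 2 = s2"
    using max
  proof eventually_elim
    case (elim t)
    show ?case
    proof
      assume t: "t \<in> I"
      with elim have "u t $ 2 * k = \<bar>k\<bar>"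
        using h1[OF t] k[OF t] by (simp add: maximum_condition_at_def Ham_def)
      then show "u t $ 2 = s2"
        using \<open>k \<noteq> 0\<close> by (metis abs_sgn mult.commute mult_right_cancel s2_def)
    qed
  qed

  have "AE t in lebesgue. t \<in> I \<longrightarrow> h3 (l t) = 0"
    using ode u2
  proof eventually_elim
    case (elim t)
    show ?case
    proof
      assume t: "t \<in> I"
      then have "((\<lambda>t. h1 (l t)) has_real_derivative - (u t $ 2) * h3 (l t))
          (at t within {0..T})"
        using elim(1) by (simp add: extremal_ode_at_def)
      then have "- (u t $ 2) * h3 (l t) = 0"
        using I(1) IT t h1 by (rule zero_on_open_imp_derivative_zero)
      \<comment> \<open>The factor \<open>u t $ 2\<close> equals \<open>s2\<close>, hence is
        nonzero.\<close>
      then show "h3 (l t) = 0" using elim(2) t s2 by auto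
    qed
  qed
  \<comment> \<open>Vanishing at every point of \<open>I\<close> is what allows \<open>h3\<close> to
    be differentiated in its turn.\<close>
  then have h3: "h3 (l t) = 0" if "t \<in> I" for t
    using AE_zero_continuous_open[OF I(1) continuous_on_h3[OF cont] _ that] by blast
  have u1: "AE t in lebesgue. t \<in> I \<longrightarrow> u t $ 1 * h4 (l t) + s2 * h5 (l t) = 0"
    using ode u2
  proof eventually_elim
    case (elim t)
    show ?case
    proof
      assume t: "t \<in> I"
      then have "((\<lambda>t. h3 (l t)) has_real_derivative u t $ 1 * h4 (l t) + u t $ 2 * h5 (l t))
          (at t within {0..T})"
        using elim(1) by (simp add: extremal_ode_at_def)
      then have "u t $ 1 * h4 (l t) + u t $ 2 * h5 (l t) = 0"
        using I(1) IT t h3 by (rule zero_on_open_imp_derivative_zero)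
      then show "u t $ 1 * h4 (l t) + s2 * h5 (l t) = 0" using elim(2) t by simp
    qed
  qed

  have h4_eq: "X4 = (\<lambda>_. axis 4 1)" and h5_eq: "X5 = (\<lambda>_. axis 5 1)"
    by (simp_all add: fun_eq_iff X4_def X5_def)
  \<comment> \<open>A derivative that vanishes only almost everywhere would not suffice by itself;
    the Lipschitz bound excludes behaviour like that of the Cantor function.\<close>
  have "(\<lambda>t. h4 (l t)) constant_on I"
  proof (rule lipschitz_AE_zero_derivative_constant_on[OF _ I(2)])
    show "L-lipschitz_on I (\<lambda>t. h4 (l t))"
      unfolding h4_eq by (rule lipschitz_on_lin_ham_const[OF lip]) (simp add: norm_axis_1)
    show "AE t in lebesgue. t \<in> I \<longrightarrow> ((\<lambda>t. h4 (l t)) has_real_derivative 0) (at t within I)"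
      using ode by eventually_elim
        (auto simp: extremal_ode_at_def intro: has_field_derivative_subset[OF _ IT])
  qed
  then obtain a where a: "\<And>t. t \<in> I \<Longrightarrow> h4 (l t) = a" by (auto simp: constant_on_def)
  have "(\<lambda>t. h5 (l t)) constant_on I"
  proof (rule lipschitz_AE_zero_derivative_constant_on[OF _ I(2)])
    show "L-lipschitz_on I (\<lambda>t. h5 (l t))"
      unfolding h5_eq by (rule lipschitz_on_lin_ham_const[OF lip]) (simp add: norm_axis_1)
    show "AE t in lebesgue. t \<in> I \<longrightarrow> ((\<lambda>t. h5 (l t)) has_real_derivative 0) (at t within I)"
      using ode by eventually_elim
        (auto simp: extremal_ode_at_def intro: has_field_derivative_subset[OF _ IT])
  qed
  then obtain b where b: "\<And>t. t \<in> I \<Longrightarrow> h5 (l t) = b" by (auto simp: constant_on_def)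

  have rel: "AE t in lebesgue. t \<in> I \<longrightarrow> \<bar>u t $ 1\<bar> \<le> 1 \<and> u t $ 2 = s2 \<and> u t $ 1 * a + s2 * b = 0"
    using adm u2 u1 by eventually_elim (auto simp: U_def a b)
  \<comment> \<open>A single time at which the relation holds yields a value \<open>v\<close> of the
    first control, and this settles the constants: it forces \<open>b = 0\<close> if
    \<open>a = 0\<close>, and bounds \<open>b / a\<close> otherwise. If there were no such time, the
    constant function 1 would vanish almost everywhere on the nonempty open set
    \<open>I\<close>.\<close>
  have "\<exists>t\<in>I. \<bar>u t $ 1\<bar> \<le> 1 \<and> u t $ 1 * a + s2 * b = 0"
  proof (rule ccontr)
    assume "\<not> ?thesis"
    then have "AE t in lebesgue. t \<in> I \<longrightarrow> (1::real) = 0"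
      using rel by (auto elim!: eventually_mono)
    then show False
      using AE_zero_continuous_open[OF I(1) continuous_on_const _ t0, of 1] by simp
  qed
  then obtain v where v: "\<bar>v\<bar> \<le> 1" "v * a + s2 * b = 0" by blast

  show ?thesis
  proof (cases "a = 0")
    case True
    then have "b = 0" using v s2 by auto
    have "AE t in lebesgue_on {\<alpha><..<\<beta>}. \<bar>u t $ 1\<bar> \<le> 1 \<and> u t $ 2 = s2"
      using rel by (intro to_I) (auto elim!: eventually_mono)
    then show ?thesis
      using True \<open>b = 0\<close> h1 h3 a b k \<open>k \<noteq> 0\<close> s2 unfolding I_def by blast
  next
    case False
    \<comment> \<open>Here 1 / \<open>s2\<close> plays no part: solving for \<open>v\<close> and
      using \<bar>\<open>s2\<close>\<bar> = 1 turns the control bound \<bar>\<open>v\<close>\<bar>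
      \<le> 1 into the bound on the ratio.\<close>
    have "v = - s2 * (b / a)"
      using v(2) False by (simp add: field_simps)
    then have ba: "\<bar>b / a\<bar> \<le> 1" using v(1) s2 by auto
    have "AE t in lebesgue_on {\<alpha><..<\<beta>}.
        u t $ 1 = - s2 * (h5 (l t) / h4 (l t)) \<and> u t $ 2 = s2"
    proof (rule to_I)
      show "AE t in lebesgue. t \<in> I \<longrightarrow>
          u t $ 1 = - s2 * (h5 (l t) / h4 (l t)) \<and> u t $ 2 = s2"
        using rel by eventually_elim (use False in \<open>auto simp: a b field_simps\<close>)
    qed
    moreover have "\<forall>t\<in>I. h1 (l t) = 0 \<and> h3 (l t) = 0 \<and> h4 (l t) \<noteq> 0 \<and> \<bar>h5 (l t) / h4 (l t)\<bar> \<le> 1"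
      using h1 h3 False ba by (simp add: a b)
    ultimately show ?thesis
      using k \<open>k \<noteq> 0\<close> s2 unfolding I_def by blast
  qed
qed

end
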